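(* The following two statements are equivalent. (A) For every positive integer $n$ and all distinct positive integers $a_1,\dots,a_n$, one has $\max_{i,j}\frac{a_i}{\gcd(a_i,a_j)}\ge n$. (B) For every positive integer $n$ and every subset $S\subseteq F_n$ with $\mathcal{Q}(S)\subseteq F_n$, one has $|S|\le n+1$.
   Context: For a positive integer $n$, $F_n$ (the Farey sequence of order $n$) is the set of rational numbers $a/b$ with integers $0\le a\le b\le n$, $b\ge 1$, $\gcd(a,b)=1$. For a set $S$ of real numbers, $\mathcal{Q}(S)=\{x/y : x,y\in S,\ x\le y,\ y\neq 0\}$; by convention, if $S=\{0\}$ then $\mathcal{Q}(S)=\{0\}$. *)

theory Defs
  imports Complex_Main
begin

definition farey :: "nat \<Rightarrow> real set" where
  "farey n = {real a / real b | a b :: nat. a \<le> b \<and> b \<le> n \<and> 1 \<le> b \<and> coprime a b}"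

definition quotient_set :: "real set \<Rightarrow> real set" where
  "quotient_set S = (if S = {0} then {0} else {x / y | x y. x \<in> S \<and> y \<in> S \<and> x \<le> y \<and> y \<noteq> 0})"

text \<open>Every subset of a Farey sequence is finite, so \<open>card\<close> is its genuine cardinality.\<close>

lemma finite_farey: "finite (farey n)"
proof -
  have "farey n \<subseteq> (\<lambda>(a, b). real a / real b) ` ({..n} \<times> {..n})"
    by (auto simp: farey_def)
  then show ?thesis
    by (rule finite_subset) simp
qed

end

theory Submission
  imports Defs
begin

text \<open>Scaling a set of rationals to a set of positive integers does not change its quotients, and
  \<open>a / b\<close> has reduced denominator \<open>b / gcd a b\<close>. So a set of positive integers all of whose values
  \<open>x / gcd x y\<close> are at most \<open>n\<close>, divided by its maximum, is the same thing as a subset of \<open>farey n\<close>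
  without \<open>0\<close> whose quotients stay in \<open>farey n\<close>. The element \<open>0\<close> can always be adjoined, which
  accounts for the bound \<open>n + 1\<close> instead of \<open>n\<close>.\<close>

lemma quotient_in_farey_iff:
  fixes a b :: nat
  assumes "a > 0" "a \<le> b"
  shows "real a / real b \<in> farey n \<longleftrightarrow> b div gcd a b \<le> n"
proof -
  define g where "g = gcd a b"
  have "g > 0" unfolding g_def using assms by simp
  then obtain a' b' where ab: "a = a' * g" "b = b' * g" "coprime a' b'"
    using gcd_coprime_exists[of a b] unfolding g_def by auto
  have "b' > 0" using ab assms by (cases b') auto
  have "a' \<le> b'" using ab assms \<open>g > 0\<close> by simp
  have ratio: "real a / real b = real a' / real b'"
    using ab \<open>g > 0\<close> by simp
  have "real a / real b \<in> farey n \<longleftrightarrow> b' \<le> n"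
  proof
    assume "real a / real b \<in> farey n"
    then obtain p q where pq: "real a' / real b' = real p / real q" "q \<le> n" "1 \<le> q"
      by (auto simp: farey_def ratio)
    then have "real a' * real q = real p * real b'"
      using \<open>b' > 0\<close> by (simp add: field_simps)
    then have "a' * q = p * b'"
      by (metis of_nat_eq_iff of_nat_mult)
    \<comment> \<open>Coprimality of \<open>a'\<close> and \<open>b'\<close> lets \<open>a'\<close>
      be cancelled, so \<open>b'\<close> divides the denominator of any fraction with the same value
      and is therefore the least one.\<close>
    then have "b' dvd a' * q" by simp
    then have "b' dvd q"
      using ab by (simp add: coprime_commute coprime_dvd_mult_right_iff)
    then show "b' \<le> n"
      using pq by (auto dest: dvd_imp_le)
  next
    assume "b' \<le> n"
    moreover have "1 \<le> b'" using \<open>b' > 0\<close> by simp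
    ultimately show "real a / real b \<in> farey n"
      unfolding ratio farey_def using \<open>a' \<le> b'\<close> ab by blast
  qed
  moreover have "b div gcd a b = b'"
    unfolding g_def[symmetric] using ab(2) \<open>g > 0\<close> by simp
  ultimately show ?thesis by simp
qed

lemma zero_in_farey: "n \<ge> 1 \<Longrightarrow> 0 \<in> farey n"
  unfolding farey_def by (intro CollectI exI[of _ 0] exI[of _ 1]) auto

text \<open>Each denominator up to \<open>n\<close> divides \<open>fact n\<close>, so one scaling
  factor turns every subset of \<open>farey n\<close> into a set of natural numbers.\<close>

lemma farey_common_denominator:
  assumes "s \<in> farey n"
  obtains k :: nat where "s = real k / fact n"
proof -
  obtain p q where pq: "s = real p / real q" "q \<le> n" "1 \<le> q"
    using assms by (auto simp: farey_def)
  then obtain m where m: "(fact n :: nat) = q * m"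
    using dvd_fact[of q n] by auto
  have "fact n = real q * real m"
    using m by (metis of_nat_fact of_nat_mult)
  moreover have "m \<noteq> 0"
    using m by (metis fact_nonzero mult_0_right)
  ultimately have "s = real (p * m) / fact n"
    using pq by simp
  then show ?thesis by (rule that)
qed

text \<open>The maximum runs over a finite nonempty set, so bounding it below means finding one
  large member; since the gcd divides \<open>a i\<close>, real division agrees with
  \<open>div\<close>.\<close>

lemma Max_gcd_ratio_ge_iff:
  fixes a :: "nat \<Rightarrow> nat"
  assumes "n \<ge> 1"
  shows "Max {real (a i) / real (gcd (a i) (a j)) | i j. i \<in> {1..n} \<and> j \<in> {1..n}} \<ge> real n
    \<longleftrightarrow> (\<exists>x\<in>a ` {1..n}. \<exists>y\<in>a ` {1..n}. n \<le> x div gcd x y)"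
proof -
  let ?M = "{real (a i) / real (gcd (a i) (a j)) | i j. i \<in> {1..n} \<and> j \<in> {1..n}}"
  have M: "?M = (\<lambda>(i, j). real (a i div gcd (a i) (a j))) ` ({1..n} \<times> {1..n})"
    by (fastforce simp: real_of_nat_div)
  have "finite ?M" unfolding M by simp
  moreover have "?M \<noteq> {}" unfolding M using assms by auto
  ultimately have "Max ?M \<ge> real n \<longleftrightarrow> (\<exists>x\<in>?M. real n \<le> x)"
    by (rule Max_ge_iff)
  also have "\<dots> \<longleftrightarrow> (\<exists>x\<in>a ` {1..n}. \<exists>y\<in>a ` {1..n}. n \<le> x div gcd x y)"
    unfolding M by auto
  finally show ?thesis .
qed

text \<open>An injective \<open>a\<close> merely enumerates its image, a set of cardinality
  \<open>n\<close>, and every finite nonempty set can be enumerated from 1 in this way.\<close>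

lemma graham_indexed_iff_set:
  "(\<forall>(n::nat) (a :: nat \<Rightarrow> nat).
      n \<ge> 1 \<and> inj_on a {1..n} \<and> (\<forall>i\<in>{1..n}. a i > 0) \<longrightarrow>
      Max {real (a i) / real (gcd (a i) (a j)) | i j. i \<in> {1..n} \<and> j \<in> {1..n}} \<ge> real n)
   \<longleftrightarrow> (\<forall>T :: nat set. finite T \<and> T \<noteq> {} \<and> 0 \<notin> T \<longrightarrow>
      (\<exists>x\<in>T. \<exists>y\<in>T. card T \<le> x div gcd x y))" (is "?I \<longleftrightarrow> ?S")
proof
  assume I: ?I
  show ?S
  proof (intro allI impI)
    fix T :: "nat set"
    assume T: "finite T \<and> T \<noteq> {} \<and> 0 \<notin> T"
    then obtain a where "bij_betw a {1..card T} T"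
      using ex_bij_betw_nat_finite_1 by blast
    then have a: "inj_on a {1..card T}" "a ` {1..card T} = T"
      by (auto simp: bij_betw_def)
    have n: "card T \<ge> 1" using T by (simp add: Suc_le_eq card_gt_0_iff)
    have "\<forall>i\<in>{1..card T}. a i > 0" using a T by (metis imageI gr0I)
    then show "\<exists>x\<in>T. \<exists>y\<in>T. card T \<le> x div gcd x y"
      using I n a Max_gcd_ratio_ge_iff[OF n, of a] by blast
  qed
next
  assume S: ?S
  show ?I
  proof (intro allI impI)
    fix n :: nat and a :: "nat \<Rightarrow> nat"
    assume *: "n \<ge> 1 \<and> inj_on a {1..n} \<and> (\<forall>i\<in>{1..n}. a i > 0)"
    then have "card (a ` {1..n}) = n" "a ` {1..n} \<noteq> {}" "0 \<notin> a ` {1..n}"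
      by (auto simp: card_image)
    then have "\<exists>x\<in>a ` {1..n}. \<exists>y\<in>a ` {1..n}. n \<le> x div gcd x y"
      using S by (metis finite_atLeastAtMost finite_imageI)
    then show "Max {real (a i) / real (gcd (a i) (a j)) | i j. i \<in> {1..n} \<and> j \<in> {1..n}} \<ge> real n"
      using * Max_gcd_ratio_ge_iff by blast
  qed
qed

text \<open>Scaling the nonzero part of \<open>S\<close> by \<open>fact n\<close> preserves
  quotients and cardinality. The pair supplied by \<open>graham\<close> has a value at least
  \<open>card T\<close>, while every value is at most \<open>n\<close>.\<close>

lemma card_le_if_graham:
  assumes graham: "\<And>T :: nat set. finite T \<Longrightarrow> T \<noteq> {} \<Longrightarrow> 0 \<notin> T \<Longrightarrow>
      \<exists>x\<in>T. \<exists>y\<in>T. card T \<le> x div gcd x y"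
    and S: "S \<subseteq> farey n" "quotient_set S \<subseteq> farey n"
  shows "card S \<le> n + 1"
proof (cases "S - {0} = {}")
  case True
  then have "card S \<le> card {0 :: real}"
    by (intro card_mono) auto
  then show ?thesis by simp
next
  case False
  have "finite S" using S finite_farey finite_subset by blast
  have "\<forall>s\<in>S. \<exists>k::nat. s = real k / fact n"
    using S by (meson farey_common_denominator subsetD)
  then obtain f :: "real \<Rightarrow> nat" where f: "\<And>s. s \<in> S \<Longrightarrow> s = real (f s) / fact n"
    by metis
  define T where "T = f ` (S - {0})"
  have "inj_on f S" using f by (metis inj_onI)
  then have "card T = card (S - {0})"
    unfolding T_def by (intro card_image) (meson Diff_subset inj_on_subset)
  \<comment> \<open>Only the quotient smaller over larger is known to lie in \<open>farey n\<close>,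
    and it bounds the value with \<open>y\<close> on top; the other value is smaller still. Both are
    recorded because the pair from \<open>graham\<close> comes in no particular order.\<close>
  have bound: "y div gcd x y \<le> n \<and> x div gcd x y \<le> n" if "x \<in> T" "y \<in> T" "x \<le> y" for x y
  proof -
    obtain s t where st: "s \<in> S" "s \<noteq> 0" "x = f s" "t \<in> S" "t \<noteq> 0" "y = f t"
      using \<open>x \<in> T\<close> \<open>y \<in> T\<close> by (auto simp: T_def)
    have s: "s = real x / fact n" and t: "t = real y / fact n"
      using f st by auto
    have "s / t = real x / real y" unfolding s t by simp
    moreover have "s \<le> t" unfolding s t using \<open>x \<le> y\<close> by (simp add: divide_right_mono)
    then have "s / t \<in> quotient_set S"
      using st by (auto simp: quotient_set_def)
    ultimately have "real x / real y \<in> farey n" using S by auto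
    moreover have "x > 0" using s st by (metis div_0 gr0I of_nat_0)
    ultimately have "y div gcd x y \<le> n"
      using quotient_in_farey_iff \<open>x \<le> y\<close> by blast
    moreover have "x div gcd x y \<le> y div gcd x y"
      using \<open>x \<le> y\<close> by (rule div_le_mono)
    ultimately show ?thesis by simp
  qed
  have "0 \<notin> T" using f by (force simp: T_def)
  moreover have "finite T" "T \<noteq> {}" using \<open>finite S\<close> False by (auto simp: T_def)
  ultimately obtain x y where "x \<in> T" "y \<in> T" "card T \<le> x div gcd x y"
    using graham by blast
  then have "card T \<le> n"
    using bound by (metis gcd.commute le_trans nat_le_linear)
  \<comment> \<open>The possible element 0 accounts for the extra 1.\<close>
  moreover have "card S \<le> card (S - {0}) + 1"
    by (simp add: card_Diff_singleton_if) linarith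
  ultimately show ?thesis using \<open>card T = card (S - {0})\<close> by simp
qed

text \<open>A counterexample \<open>T\<close> has all its values at most \<open>card T - 1\<close>.
  Dividing it by its maximum and adjoining 0 gives a set of \<open>card T + 1\<close> elements, one
  more than the Farey bound of that order allows.\<close>

lemma graham_if_card_le:
  fixes T :: "nat set"
  assumes farey_bound: "\<And>n S. n \<ge> 1 \<Longrightarrow> S \<subseteq> farey n \<Longrightarrow> quotient_set S \<subseteq> farey n \<Longrightarrow> card S \<le> n + 1"
    and T: "finite T" "T \<noteq> {}" "0 \<notin> T"
  shows "\<exists>x\<in>T. \<exists>y\<in>T. card T \<le> x div gcd x y"
proof (rule ccontr)
  assume "\<not> ?thesis"
  then have less: "x div gcd x y < card T" if "x \<in> T" "y \<in> T" for x y
    using that by (meson not_le)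
  define n where "n = card T - 1"
  define M where "M = Max T"
  have M: "M \<in> T" "\<And>x. x \<in> T \<Longrightarrow> x \<le> M" unfolding M_def using T by auto
  then have "M > 0" using T by (metis gr0I)
  \<comment> \<open>The pair \<open>M\<close>, \<open>M\<close> has value 1, which excludes a
    singleton and makes the order \<open>n\<close> positive.\<close>
  then have "1 < card T" using less[of M M] M by simp
  then have "n \<ge> 1" by (simp add: n_def)
  have ratio: "real x / real y \<in> farey n" if "x \<in> T" "y \<in> T" "x \<le> y" for x y
  proof -
    have "x > 0" using that T by (metis gr0I)
    then show ?thesis
      \<comment> \<open>The arguments of \<open>less\<close> are swapped because the reduced
        denominator of \<open>x / y\<close> is the value with \<open>y\<close> on top.\<close>
      using quotient_in_farey_iff[of x y n] less[of y x] that by (simp add: n_def gcd.commute)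
  qed
  define h :: "nat \<Rightarrow> real" where "h x = real x / real M" for x
  define S where "S = insert 0 (h ` T)"
  have "S \<subseteq> farey n"
    using ratio M zero_in_farey[OF \<open>n \<ge> 1\<close>] by (auto simp: S_def h_def)
  moreover have "quotient_set S \<subseteq> farey n"
  proof
    fix r assume "r \<in> quotient_set S"
    show "r \<in> farey n"
    \<comment> \<open>A nonzero quotient has nonzero numerator and denominator (division by 0 yields
      0), so both come from \<open>T\<close> and the factor \<open>M\<close> cancels.\<close>
    proof (cases "r = 0")
      case True
      then show ?thesis using zero_in_farey[OF \<open>n \<ge> 1\<close>] by simp
    next
      case False
      then obtain s t where st: "r = s / t" "s \<in> S" "t \<in> S" "s \<le> t"
        using \<open>r \<in> quotient_set S\<close> unfolding quotient_set_def by (auto split: if_splits)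
      then have "s \<noteq> 0" "t \<noteq> 0" using False by auto
      then obtain x y where "x \<in> T" "y \<in> T" "s = h x" "t = h y"
        using st by (auto simp: S_def)
      then show ?thesis
        using st ratio[of x y] \<open>M > 0\<close> by (simp add: h_def divide_le_cancel)
    qed
  qed
  ultimately have "card S \<le> n + 1" using farey_bound \<open>n \<ge> 1\<close> by blast
  have "inj_on h T" using \<open>M > 0\<close> by (auto simp: inj_on_def h_def)
  moreover have "0 \<notin> h ` T" using T \<open>M > 0\<close> by (auto simp: h_def)
  ultimately have "card S = card T + 1" using T by (simp add: S_def card_image)
  then show False using \<open>card S \<le> n + 1\<close> \<open>1 < card T\<close> by (simp add: n_def)
qed

theorem theorem2:
  "(\<forall>(n::nat) (a :: nat \<Rightarrow> nat).
      n \<ge> 1 \<and> inj_on a {1..n} \<and> (\<forall>i\<in>{1..n}. a i > 0) \<longrightarrow>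
      Max {real (a i) / real (gcd (a i) (a j)) | i j. i \<in> {1..n} \<and> j \<in> {1..n}} \<ge> real n)
   \<longleftrightarrow>
   (\<forall>(n::nat) (S :: real set).
      n \<ge> 1 \<and> S \<subseteq> farey n \<and> quotient_set S \<subseteq> farey n \<longrightarrow> card S \<le> n + 1)"
  unfolding graham_indexed_iff_set
proof (intro iffI allI impI; elim conjE)
  fix n :: nat and S :: "real set"
  assume "\<forall>T :: nat set. finite T \<and> T \<noteq> {} \<and> 0 \<notin> T \<longrightarrow> (\<exists>x\<in>T. \<exists>y\<in>T. card T \<le> x div gcd x y)"
    and "S \<subseteq> farey n" "quotient_set S \<subseteq> farey n"
  then show "card S \<le> n + 1" by (intro card_le_if_graham) auto
next
  fix T :: "nat set"
  assume "\<forall>n S. n \<ge> 1 \<and> S \<subseteq> farey n \<and> quotient_set S \<subseteq> farey n \<longrightarrow> card S \<le> n + 1"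
    and "finite T" "T \<noteq> {}" "0 \<notin> T"
  then show "\<exists>x\<in>T. \<exists>y\<in>T. card T \<le> x div gcd x y" by (intro graham_if_card_le) auto
qed

end
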